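(* The set $\pi_\infty$ contains the set $$\bigcup_{n\in\mathbf{Z}_+,\; r\in\{0,\dots,2^{n+2}\}} e^{\pi i r/2^{n+1}}\,[0,2^{1/2^n}],$$ and so is dense in the unit disc in $\mathbf{C}$ (that is, the unit disc is contained in the closure of $\pi_\infty\cap\{\lambda:|\lambda|\le1\}$).
   Context: $\mathbf{Z}_+$ denotes the non-negative integers, $\mathbf{N}$ the positive integers. For $z\in\mathbf{C}$ and an interval $J\subset\mathbf{R}$, $zJ=\{zt:t\in J\}$. Let $\Omega=\{\pm1\}^{\mathbf{Z}}$. For $c\in\Omega$, $A_c$ is the bounded operator on $\ell^2(\mathbf{Z})$ given by $(A_cf)_n=c_nf_{n-1}+f_{n+1}$, with spectrum $\mathrm{Spec}(A_c)$. For $N\in\mathbf{N}$ let $\pi_N$ be the union of $\mathrm{Spec}(A_c)$ over all $c\in\Omega$ that are periodic with period $\le N$, and let $\pi_\infty=\bigcup_{N\in\mathbf{N}}\pi_N$. *)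

theory Defs
  imports "HOL-Analysis.Analysis"
begin

definition ell2 :: "(int \<Rightarrow> complex) set" where
  "ell2 = {f. (\<lambda>n. (cmod (f n))\<^sup>2) summable_on UNIV}"

definition ell2_norm :: "(int \<Rightarrow> complex) \<Rightarrow> real" where
  "ell2_norm f = sqrt (\<Sum>\<^sub>\<infinity>n. (cmod (f n))\<^sup>2)"

text \<open>Operators are functions on all sequences; only their restriction to \<^const>\<open>ell2\<close> matters.\<close>

definition bounded_op :: "((int \<Rightarrow> complex) \<Rightarrow> (int \<Rightarrow> complex)) \<Rightarrow> bool" where
  "bounded_op T \<longleftrightarrow>
     (\<forall>f\<in>ell2. T f \<in> ell2) \<and>
     (\<forall>f\<in>ell2. \<forall>g\<in>ell2. T (\<lambda>n. f n + g n) = (\<lambda>n. T f n + T g n)) \<and>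
     (\<forall>a. \<forall>f\<in>ell2. T (\<lambda>n. a * f n) = (\<lambda>n. a * T f n)) \<and>
     (\<exists>K. \<forall>f\<in>ell2. ell2_norm (T f) \<le> K * ell2_norm f)"

text \<open>The complement of the set of \<open>z\<close> for which \<open>T - z I\<close> has a bounded two-sided inverse.\<close>

definition Spec :: "((int \<Rightarrow> complex) \<Rightarrow> (int \<Rightarrow> complex)) \<Rightarrow> complex set" where
  "Spec T = {z. \<not> (\<exists>B. bounded_op B \<and>
     (\<forall>f\<in>ell2. B (\<lambda>n. T f n - z * f n) = f \<and> (\<lambda>n. T (B f) n - z * B f n) = f))}"

definition Omega :: "(int \<Rightarrow> complex) set" where
  "Omega = {c. \<forall>n. c n \<in> {1, -1}}"

definition hop :: "(int \<Rightarrow> complex) \<Rightarrow> (int \<Rightarrow> complex) \<Rightarrow> (int \<Rightarrow> complex)" where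
  "hop c f = (\<lambda>n. c n * f (n - 1) + f (n + 1))"

definition has_period :: "(int \<Rightarrow> complex) \<Rightarrow> nat \<Rightarrow> bool" where
  "has_period c p \<longleftrightarrow> p > 0 \<and> (\<forall>n. c (n + int p) = c n)"

definition pi_N :: "nat \<Rightarrow> complex set" where
  "pi_N N = (\<Union>c\<in>{c\<in>Omega. \<exists>p\<le>N. has_period c p}. Spec (hop c))"

definition pi_infinity :: "complex set" where
  "pi_infinity = (\<Union>N\<in>{1..}. pi_N N)"

definition scale_interval :: "complex \<Rightarrow> real set \<Rightarrow> complex set" where
  "scale_interval z J = {z * of_real t | t. t \<in> J}"

lemma bounded_op_hop:
  assumes "c \<in> Omega"
  shows "bounded_op (hop c)"
proof -
  have key: "hop c f \<in> ell2 \<and> ell2_norm (hop c f) \<le> 2 * ell2_norm f" if f: "f \<in> ell2" for f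
  proof -
    define g where "g n = (cmod (f n))\<^sup>2" for n
    have g: "g summable_on UNIV" using f by (simp add: ell2_def g_def[abs_def])
    have bij: "bij_betw (\<lambda>n::int. n + k) UNIV UNIV" for k
      by (rule bij_betwI[where g = "\<lambda>n. n - k"]) auto
    have s: "(\<lambda>n. g (n + k)) summable_on UNIV" for k
      using summable_on_reindex_bij_betw[OF bij, of g k] g by simp
    have i: "(\<Sum>\<^sub>\<infinity>n. g (n + k)) = infsum g UNIV" for k
      using infsum_reindex_bij_betw[OF bij, of g k] by simp
    have bd: "(cmod (hop c f n))\<^sup>2 \<le> 2 * g (n + -1) + 2 * g (n + 1)" for n
    proof -
      have "cmod (c n) = 1" using assms by (auto simp: Omega_def dest: spec[of _ n])
      hence "cmod (hop c f n) \<le> cmod (f (n - 1)) + cmod (f (n + 1))"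
        unfolding hop_def by (metis mult_1 norm_mult norm_triangle_ineq)
      hence "(cmod (hop c f n))\<^sup>2 \<le> (cmod (f (n - 1)) + cmod (f (n + 1)))\<^sup>2"
        by (intro power_mono) auto
      also have "\<dots> \<le> 2 * (cmod (f (n - 1)))\<^sup>2 + 2 * (cmod (f (n + 1)))\<^sup>2"
        using zero_le_power2[of "cmod (f (n - 1)) - cmod (f (n + 1))"]
        by (simp add: power2_sum power2_diff)
      finally show ?thesis by (simp add: g_def)
    qed
    have s2: "(\<lambda>n. 2 * g (n + -1) + 2 * g (n + 1)) summable_on UNIV"
      by (intro summable_on_add summable_on_cmult_right s)
    have s3: "(\<lambda>n. (cmod (hop c f n))\<^sup>2) summable_on UNIV"
      by (rule summable_on_comparison_test[OF s2]) (use bd in auto)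
    have "(\<Sum>\<^sub>\<infinity>n. (cmod (hop c f n))\<^sup>2) \<le> (\<Sum>\<^sub>\<infinity>n. 2 * g (n + -1) + 2 * g (n + 1))"
      by (rule infsum_mono[OF s3 s2]) (use bd in auto)
    also have "\<dots> = 2 * (\<Sum>\<^sub>\<infinity>n. g (n + -1)) + 2 * (\<Sum>\<^sub>\<infinity>n. g (n + 1))"
      by (subst infsum_add) (auto intro!: summable_on_cmult_right s simp only: infsum_cmult_right')
    also have "\<dots> = 4 * infsum g UNIV"
      unfolding i by simp
    finally have "ell2_norm (hop c f) \<le> sqrt (4 * infsum g UNIV)"
      by (simp add: ell2_norm_def)
    also have "\<dots> = 2 * ell2_norm f"
      by (simp add: ell2_norm_def g_def[abs_def] real_sqrt_mult)
    finally show ?thesis using s3 by (simp add: ell2_def)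
  qed
  show ?thesis
    unfolding bounded_op_def
  proof (intro conjI)
    show "\<exists>K. \<forall>f\<in>ell2. ell2_norm (hop c f) \<le> K * ell2_norm f"
      using key by (intro exI[of _ 2]) blast
  qed (use key in \<open>auto simp: hop_def algebra_simps\<close>)
qed

end

theory Submission
  imports Defs
begin

text \<open>
  The heart of the matter is that \<^const>\<open>pi_infinity\<close> is closed under taking complex square
  roots. Given a periodic \<open>b \<in> \<Omega>\<close>, choose signs \<open>s\<^sub>m\<close> with \<open>s\<^sub>m = - b\<^sub>m s\<^sub>m\<^sub>-\<^sub>1\<close> and put
  \<open>c = (\<dots>, s\<^sub>0, - s\<^sub>0, s\<^sub>1, - s\<^sub>1, \<dots>)\<close>. Squaring,
  \<open>(A\<^sub>c\<^sup>2 f)\<^sub>n = c\<^sub>n c\<^sub>n\<^sub>-\<^sub>1 f\<^sub>n\<^sub>-\<^sub>2 + (c\<^sub>n + c\<^sub>n\<^sub>+\<^sub>1) f\<^sub>n + f\<^sub>n\<^sub>+\<^sub>2\<close>.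
  At even \<open>n = 2m\<close> the diagonal term cancels and the coefficient of \<open>f\<^sub>n\<^sub>-\<^sub>2\<close> is \<open>b\<^sub>m\<close>,
  so on sequences supported on the even integers the square of \<open>A\<^sub>c\<close> is a copy of \<open>A\<^sub>b\<close>. Hence
  \<open>z\<^sup>2 \<in> Spec A\<^sub>b\<close> forces \<open>z\<close> or \<open>- z\<close> into \<open>Spec A\<^sub>c\<close>, and \<open>Spec A\<^sub>c\<close> is symmetric about the
  origin because conjugation by the signs \<open>(-1)\<^sup>n\<close> turns \<open>A\<^sub>c\<close> into \<open>- A\<^sub>c\<close>
  (\<open>pi_infinity_square_root\<close>). The sequence \<open>c\<close> is again periodic.

  Plane waves \<open>n \<mapsto> u\<^sup>n\<close> with \<open>\<bar>u\<bar> = 1\<close> are bounded eigenfunctions for the two constant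
  sequences, so \<^const>\<open>pi_infinity\<close> contains \<open>[-2,2]\<close> and \<open>\<i>[-2,2]\<close>
  (\<open>coordinate_axes_subset_pi_infinity\<close>). The power \<open>2\<^sup>n\<close> maps the rays of level \<open>n\<close> into
  this cross, and extracting square roots \<open>n\<close> times yields the first claim. The second follows
  as the directions \<open>\<pi> r / 2\<^sup>n\<^sup>+\<^sup>1\<close> become dense on the circle while every ray has length at
  least 1.
\<close>

section \<open>Bounded and invertible operators on square-summable sequences\<close>

lemma ell2_norm_nonneg: "ell2_norm f \<ge> 0"
  by (simp add: ell2_norm_def infsum_nonneg)

lemma bounded_op_in_ell2: "bounded_op T \<Longrightarrow> f \<in> ell2 \<Longrightarrow> T f \<in> ell2"
  by (simp add: bounded_op_def)

lemma bounded_op_compose: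
  assumes S: "bounded_op S" and T: "bounded_op T"
  shows "bounded_op (\<lambda>f. S (T f))"
proof -
  obtain K where K: "\<And>f. f \<in> ell2 \<Longrightarrow> ell2_norm (S f) \<le> K * ell2_norm f"
    using S unfolding bounded_op_def by blast
  obtain L where L: "\<And>f. f \<in> ell2 \<Longrightarrow> ell2_norm (T f) \<le> L * ell2_norm f"
    using T unfolding bounded_op_def by blast
  have "ell2_norm (S (T f)) \<le> \<bar>K\<bar> * L * ell2_norm f" if f: "f \<in> ell2" for f
  proof -
    have "ell2_norm (S (T f)) \<le> K * ell2_norm (T f)"
      using K bounded_op_in_ell2[OF T f] .
    also have "\<dots> \<le> \<bar>K\<bar> * ell2_norm (T f)"
      by (intro mult_right_mono ell2_norm_nonneg) simp
    also have "\<dots> \<le> \<bar>K\<bar> * (L * ell2_norm f)"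
      by (intro mult_left_mono L f) simp
    finally show ?thesis by (simp add: mult.assoc)
  qed
  thus ?thesis
    using S T unfolding bounded_op_def by (auto intro!: exI[of _ "\<bar>K\<bar> * L"])
qed

lemma bounded_op_contraction:
  assumes add: "\<And>f g. T (\<lambda>n. f n + g n) = (\<lambda>n. T f n + T g n)"
    and scale: "\<And>a f. T (\<lambda>n. a * f n) = (\<lambda>n. a * T f n)"
    and ell2: "\<And>f. f \<in> ell2 \<Longrightarrow> T f \<in> ell2"
    and le: "\<And>f. f \<in> ell2 \<Longrightarrow> (\<Sum>\<^sub>\<infinity>n. (cmod (T f n))\<^sup>2) \<le> (\<Sum>\<^sub>\<infinity>n. (cmod (f n))\<^sup>2)"
  shows "bounded_op T"
  unfolding bounded_op_def using assms
  by (auto simp: ell2_norm_def intro!: exI[of _ 1])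

definition ell2_invertible :: "((int \<Rightarrow> complex) \<Rightarrow> (int \<Rightarrow> complex)) \<Rightarrow> bool" where
  "ell2_invertible T \<longleftrightarrow> (\<exists>B. bounded_op B \<and> (\<forall>f\<in>ell2. B (T f) = f \<and> T (B f) = f))"

lemma Spec_iff_not_invertible: "z \<in> Spec T \<longleftrightarrow> \<not> ell2_invertible (\<lambda>f n. T f n - z * f n)"
  by (simp add: Spec_def ell2_invertible_def)

lemma ell2_invertible_compose:
  assumes "ell2_invertible S" "ell2_invertible T" "\<And>f. f \<in> ell2 \<Longrightarrow> T f \<in> ell2"
  shows "ell2_invertible (\<lambda>f. S (T f))"
proof -
  obtain B where B: "bounded_op B" "\<And>f. f \<in> ell2 \<Longrightarrow> B (S f) = f" "\<And>f. f \<in> ell2 \<Longrightarrow> S (B f) = f"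
    using assms(1) by (auto simp: ell2_invertible_def)
  obtain C where C: "bounded_op C" "\<And>f. f \<in> ell2 \<Longrightarrow> C (T f) = f" "\<And>f. f \<in> ell2 \<Longrightarrow> T (C f) = f"
    using assms(2) by (auto simp: ell2_invertible_def)
  show ?thesis
    unfolding ell2_invertible_def
    using B C assms(3) bounded_op_in_ell2[OF B(1)]
    by (intro exI[of _ "\<lambda>f. C (B f)"]) (simp add: bounded_op_compose)
qed

text \<open>
  If \<open>E\<close> embeds a space as a direct summand with projection \<open>R\<close> and both intertwine \<open>T\<close> with
  \<open>U\<close>, then \<open>U\<close> is the part of \<open>T\<close> in a reducing subspace, and the compression \<open>R T\<^sup>-\<^sup>1 E\<close> inverts it.
\<close>

lemma ell2_invertible_reducing_part:
  assumes T: "ell2_invertible T" and R: "bounded_op R" and E: "bounded_op E"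
    and RE: "\<And>f. f \<in> ell2 \<Longrightarrow> R (E f) = f"
    and RT: "\<And>f. f \<in> ell2 \<Longrightarrow> R (T f) = U (R f)"
    and TE: "\<And>f. f \<in> ell2 \<Longrightarrow> E (U f) = T (E f)"
  shows "ell2_invertible U"
proof -
  obtain B where B: "bounded_op B" "\<And>f. f \<in> ell2 \<Longrightarrow> B (T f) = f" "\<And>f. f \<in> ell2 \<Longrightarrow> T (B f) = f"
    using T by (auto simp: ell2_invertible_def)
  have "R (B (E (U f))) = f \<and> U (R (B (E f))) = f" if f: "f \<in> ell2" for f
  proof
    have Ef: "E f \<in> ell2" using bounded_op_in_ell2[OF E f] .
    show "R (B (E (U f))) = f" using f Ef by (simp add: TE B RE)
    have "U (R (B (E f))) = R (T (B (E f)))"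
      using RT[OF bounded_op_in_ell2[OF B(1) Ef]] by simp
    thus "U (R (B (E f))) = f" using f Ef by (simp add: B RE)
  qed
  moreover have "bounded_op (\<lambda>f. R (B (E f)))"
    by (intro bounded_op_compose[OF R] bounded_op_compose[OF B(1)] E)
  ultimately show ?thesis unfolding ell2_invertible_def by blast
qed

section \<open>Symmetry of the spectrum about the origin\<close>

lemma ell2_invertible_sign_multiplication:
  assumes "\<sigma> \<in> Omega"
  shows "ell2_invertible (\<lambda>f n. \<sigma> n * f n)"
proof -
  have \<sigma>: "\<sigma> n = 1 \<or> \<sigma> n = - 1" for n using assms by (auto simp: Omega_def)
  have norm: "cmod (\<sigma> n * z) = cmod z" and inv: "\<sigma> n * (\<sigma> n * z) = z" for n z
    using \<sigma>[of n] by auto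
  have "bounded_op (\<lambda>f n. \<sigma> n * f n)"
    by (rule bounded_op_contraction) (simp_all add: norm ell2_def distrib_left mult.left_commute)
  thus ?thesis
    unfolding ell2_invertible_def by (intro exI[of _ "\<lambda>f n. \<sigma> n * f n"]) (simp add: inv)
qed

lemma ell2_add:
  assumes "f \<in> ell2" "g \<in> ell2"
  shows "(\<lambda>n. f n + g n) \<in> ell2"
proof -
  have "(cmod (f n + g n))\<^sup>2 \<le> 2 * (cmod (f n))\<^sup>2 + 2 * (cmod (g n))\<^sup>2" for n
  proof -
    have "(cmod (f n + g n))\<^sup>2 \<le> (cmod (f n) + cmod (g n))\<^sup>2"
      by (intro power_mono norm_triangle_ineq) simp
    also have "\<dots> \<le> 2 * (cmod (f n))\<^sup>2 + 2 * (cmod (g n))\<^sup>2"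
      using zero_le_power2[of "cmod (f n) - cmod (g n)"] by (simp add: power2_sum power2_diff)
    finally show ?thesis .
  qed
  moreover have "(\<lambda>n. 2 * (cmod (f n))\<^sup>2 + 2 * (cmod (g n))\<^sup>2) summable_on UNIV"
    using assms by (intro summable_on_add summable_on_cmult_right) (auto simp: ell2_def)
  ultimately show ?thesis
    unfolding ell2_def by (auto intro: summable_on_comparison_test)
qed

lemma ell2_scale: "f \<in> ell2 \<Longrightarrow> (\<lambda>n. a * f n) \<in> ell2"
  by (auto simp: ell2_def norm_mult power_mult_distrib intro: summable_on_cmult_right)

lemma hop_minus_in_ell2:
  assumes "c \<in> Omega" "f \<in> ell2"
  shows "(\<lambda>n. hop c f n - z * f n) \<in> ell2"
  using ell2_add[OF bounded_op_in_ell2[OF bounded_op_hop[OF assms(1)] assms(2)]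
      ell2_scale[OF assms(2), of "- z"]]
  by simp

text \<open>
  Multiplication by \<open>(-1)\<^sup>n\<close> anticommutes with any operator that connects only sites of opposite
  parity, so it conjugates \<open>A\<^sub>c + z\<close> into \<open>- (A\<^sub>c - z)\<close>.
\<close>

lemma Spec_hop_uminus:
  assumes c: "c \<in> Omega" and z: "z \<in> Spec (hop c)"
  shows "- z \<in> Spec (hop c)"
proof (rule ccontr)
  define \<sigma> :: "int \<Rightarrow> complex" where "\<sigma> n = (if even n then 1 else - 1)" for n
  define T where "T = (\<lambda>f n. hop c f n - - z * f n)"
  assume "- z \<notin> Spec (hop c)"
  hence T: "ell2_invertible T"
    by (simp only: T_def Spec_iff_not_invertible not_not)
  have T_ell2: "T f \<in> ell2" if "f \<in> ell2" for f
    unfolding T_def by (rule hop_minus_in_ell2[OF c that])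
  have \<sigma>: "\<sigma> \<in> Omega" "(\<lambda>n. - \<sigma> n) \<in> Omega" by (auto simp: \<sigma>_def Omega_def)
  have \<sigma>_ell2: "(\<lambda>n. \<sigma> n * f n) \<in> ell2" if "f \<in> ell2" for f
  proof -
    have "cmod (\<sigma> n) = 1" for n by (simp add: \<sigma>_def)
    thus ?thesis using that by (simp add: ell2_def norm_mult)
  qed
  have "ell2_invertible (\<lambda>f. T (\<lambda>n. \<sigma> n * f n))"
    by (rule ell2_invertible_compose[OF T ell2_invertible_sign_multiplication[OF \<sigma>(1)] \<sigma>_ell2])
  hence "ell2_invertible (\<lambda>f n. - \<sigma> n * T (\<lambda>n. \<sigma> n * f n) n)"
    by (rule ell2_invertible_compose[OF ell2_invertible_sign_multiplication[OF \<sigma>(2)]])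
      (intro T_ell2 \<sigma>_ell2)
  also have "(\<lambda>f n. - \<sigma> n * T (\<lambda>n. \<sigma> n * f n) n) = (\<lambda>f n. hop c f n - z * f n)"
    by (auto simp: T_def \<sigma>_def hop_def fun_eq_iff algebra_simps)
  finally show False using z by (simp add: Spec_iff_not_invertible)
qed

section \<open>Square roots of the spectrum\<close>

definition even_part :: "(int \<Rightarrow> complex) \<Rightarrow> (int \<Rightarrow> complex)" where
  "even_part f = (\<lambda>m. f (2 * m))"

definition spread :: "(int \<Rightarrow> complex) \<Rightarrow> (int \<Rightarrow> complex)" where
  "spread f = (\<lambda>n. if even n then f (n div 2) else 0)"

lemma inj_double: "inj ((*) (2::int))"
  by (simp add: inj_def)

lemma bounded_op_even_part: "bounded_op even_part"
proof (rule bounded_op_contraction)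
  fix f assume "f \<in> ell2"
  hence s: "(\<lambda>n. (cmod (f n))\<^sup>2) summable_on UNIV" by (simp add: ell2_def)
  hence s': "(\<lambda>n. (cmod (f n))\<^sup>2) summable_on range ((*) 2)"
    by (rule summable_on_subset_banach) simp
  show "even_part f \<in> ell2"
    using s' by (simp add: ell2_def even_part_def summable_on_reindex[OF inj_double] o_def)
  have "(\<Sum>\<^sub>\<infinity>n. (cmod (even_part f n))\<^sup>2) = (\<Sum>\<^sub>\<infinity>n\<in>range ((*) 2). (cmod (f n))\<^sup>2)"
    by (simp add: infsum_reindex[OF inj_double] o_def even_part_def)
  also have "\<dots> \<le> (\<Sum>\<^sub>\<infinity>n. (cmod (f n))\<^sup>2)"
    using s' s by (rule infsum_mono_neutral) auto
  finally show "(\<Sum>\<^sub>\<infinity>n. (cmod (even_part f n))\<^sup>2) \<le> (\<Sum>\<^sub>\<infinity>n. (cmod (f n))\<^sup>2)" .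
qed (simp_all add: even_part_def)

lemma bounded_op_spread: "bounded_op spread"
proof (rule bounded_op_contraction)
  fix f assume f: "f \<in> ell2"
  have z: "(cmod (spread f n))\<^sup>2 = 0" if "n \<notin> range ((*) 2)" for n
    using that by (auto simp: spread_def elim: evenE)
  have "(\<lambda>n. (cmod (spread f n))\<^sup>2) summable_on UNIV \<longleftrightarrow>
      (\<lambda>n. (cmod (spread f n))\<^sup>2) summable_on range ((*) 2)"
    by (rule summable_on_cong_neutral) (use z in auto)
  thus "spread f \<in> ell2"
    using f by (simp add: ell2_def summable_on_reindex[OF inj_double] o_def spread_def)
  have "(\<Sum>\<^sub>\<infinity>n. (cmod (spread f n))\<^sup>2) = (\<Sum>\<^sub>\<infinity>n\<in>range ((*) 2). (cmod (spread f n))\<^sup>2)"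
    by (rule infsum_cong_neutral) (use z in auto)
  also have "\<dots> = (\<Sum>\<^sub>\<infinity>n. (cmod (f n))\<^sup>2)"
    by (simp add: infsum_reindex[OF inj_double] o_def spread_def)
  finally show "(\<Sum>\<^sub>\<infinity>n. (cmod (spread f n))\<^sup>2) \<le> (\<Sum>\<^sub>\<infinity>n. (cmod (f n))\<^sup>2)" by simp
qed (auto simp: spread_def fun_eq_iff)

lemma even_part_spread [simp]: "even_part (spread f) = f"
  by (simp add: even_part_def spread_def)

text \<open>The interleaving \<open>(\<dots>, s\<^sub>0, - s\<^sub>0, s\<^sub>1, - s\<^sub>1, \<dots>)\<close>, whose consecutive pairs cancel.\<close>

definition sign_pairs :: "(int \<Rightarrow> complex) \<Rightarrow> (int \<Rightarrow> complex)" where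
  "sign_pairs s = (\<lambda>n. if even n then s (n div 2) else - s (n div 2))"

lemma hop_hop:
  "hop c (hop c f) n = c n * c (n - 1) * f (n - 2) + (c n + c (n + 1)) * f n + f (n + 2)"
  by (simp add: hop_def algebra_simps)

lemma even_part_hop_hop:
  assumes "\<And>m. s m * s (m - 1) = - b m"
  shows "even_part (hop (sign_pairs s) (hop (sign_pairs s) f)) = hop b (even_part f)"
proof
  fix m :: int
  have "(2 * m - 1) div 2 = m - 1" by simp
  hence "sign_pairs s (2 * m) * sign_pairs s (2 * m - 1) = b m"
    by (simp add: sign_pairs_def assms)
  moreover have "sign_pairs s (2 * m) + sign_pairs s (2 * m + 1) = 0"
    by (simp add: sign_pairs_def)
  ultimately show "even_part (hop (sign_pairs s) (hop (sign_pairs s) f)) m = hop b (even_part f) m"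
    unfolding even_part_def hop_hop by (simp add: hop_def algebra_simps)
qed

text \<open>At odd sites every term of \<open>A\<^sub>c\<^sup>2\<close> only sees odd sites, where a spread sequence vanishes.\<close>

lemma hop_hop_spread:
  assumes "\<And>m. s m * s (m - 1) = - b m"
  shows "hop (sign_pairs s) (hop (sign_pairs s) (spread f)) = spread (hop b f)"
proof
  fix n :: int
  show "hop (sign_pairs s) (hop (sign_pairs s) (spread f)) n = spread (hop b f) n"
  proof (cases "even n")
    case True
    then obtain m where n: "n = 2 * m" by (rule evenE)
    show ?thesis
      using fun_cong[OF even_part_hop_hop[where s = s and b = b and f = "spread f"], of m] assms
      unfolding even_part_spread by (simp add: n even_part_def spread_def)
  next
    case False
    thus ?thesis by (simp add: hop_hop spread_def)
  qed
qed

text \<open>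
  With \<open>A\<close> the hopping operator of \<open>sign_pairs s\<close>, inverting both factors of
  \<open>A\<^sup>2 - z\<^sup>2 = (A + z) (A - z)\<close> would invert its part on sequences supported on the even
  integers, which is a copy of \<open>A\<^sub>b - z\<^sup>2\<close>.
\<close>

lemma Spec_hop_square_root:
  assumes s: "sign_pairs s \<in> Omega" and b: "\<And>m. s m * s (m - 1) = - b m"
    and z: "z\<^sup>2 \<in> Spec (hop b)"
  shows "z \<in> Spec (hop (sign_pairs s))"
proof (rule ccontr)
  define A where "A = hop (sign_pairs s)"
  assume "z \<notin> Spec (hop (sign_pairs s))"
  hence "- z \<notin> Spec A" "z \<notin> Spec A"
    using Spec_hop_uminus[OF s, of "- z"] by (auto simp: A_def)
  hence "ell2_invertible (\<lambda>f n. A f n - - z * f n)" "ell2_invertible (\<lambda>f n. A f n - z * f n)"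
    by (simp_all only: Spec_iff_not_invertible not_not)
  hence "ell2_invertible (\<lambda>f. (\<lambda>f n. A f n - - z * f n) (\<lambda>n. A f n - z * f n))"
    by (rule ell2_invertible_compose) (simp add: hop_minus_in_ell2 s A_def)
  also have "(\<lambda>f. (\<lambda>f n. A f n - - z * f n) (\<lambda>n. A f n - z * f n)) = (\<lambda>f n. A (A f) n - z\<^sup>2 * f n)"
    by (simp add: A_def hop_def fun_eq_iff algebra_simps power2_eq_square)
  finally have "ell2_invertible (\<lambda>f n. A (A f) n - z\<^sup>2 * f n)" .
  hence "ell2_invertible (\<lambda>f n. hop b f n - z\<^sup>2 * f n)"
  proof (rule ell2_invertible_reducing_part[OF _ bounded_op_even_part bounded_op_spread])
    fix f
    show "even_part (\<lambda>n. A (A f) n - z\<^sup>2 * f n) = (\<lambda>n. hop b (even_part f) n - z\<^sup>2 * even_part f n)"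
      using even_part_hop_hop[of s b f, OF b] by (auto simp: A_def even_part_def fun_eq_iff)
    show "spread (\<lambda>n. hop b f n - z\<^sup>2 * f n) = (\<lambda>n. A (A (spread f)) n - z\<^sup>2 * spread f n)"
      unfolding A_def hop_hop_spread[of s b, OF b] by (auto simp: spread_def)
  qed simp
  thus False using z by (simp add: Spec_iff_not_invertible)
qed

section \<open>Closure of the periodic spectra under square roots\<close>

lemma pi_infinity_iff:
  "z \<in> pi_infinity \<longleftrightarrow> (\<exists>c\<in>Omega. \<exists>p. has_period c p \<and> z \<in> Spec (hop c))"
proof
  assume "\<exists>c\<in>Omega. \<exists>p. has_period c p \<and> z \<in> Spec (hop c)"
  then obtain c p where "c \<in> Omega" "has_period c p" "z \<in> Spec (hop c)" by blast
  thus "z \<in> pi_infinity"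
    by (auto simp: pi_infinity_def pi_N_def intro!: bexI[of _ "p"] simp: has_period_def)
qed (auto simp: pi_infinity_def pi_N_def)

lemma sign_recurrence_solvable:
  assumes "b \<in> Omega"
  obtains s where "s \<in> Omega" "\<And>m. s m * s (m - 1) = - b m"
proof -
  have b: "b m = 1 \<or> b m = - 1" for m using assms by (auto simp: Omega_def)
  have bb: "b m * b m = 1" for m using b[of m] by auto
  \<comment> \<open>Starting from \<open>s\<^sub>0 = 1\<close>, the recurrence is run forwards and backwards; as every \<open>b\<^sub>i\<close> is its
      own inverse, both directions multiply by the same factors.\<close>
  define s where "s m = (\<Prod>i\<in>{1..m}. - b i) * (\<Prod>i\<in>{m + 1..0}. - b i)" for m
  have prod: "(\<Prod>i\<in>I. - b i) \<in> {1, - 1}" for I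
  proof (induction I rule: infinite_finite_induct)
    case (insert i I) thus ?case using b[of i] by auto
  qed auto
  have s: "s m = 1 \<or> s m = - 1" for m
    using prod[of "{1..m}"] prod[of "{m + 1..0}"] by (auto simp: s_def)
  have rec: "s m = - b m * s (m - 1)" for m
  proof (cases "m \<ge> 1")
    case True
    hence "{1..m} = insert m {1..m - 1}" by auto
    thus ?thesis using True by (simp add: s_def)
  next
    case False
    hence "{m - 1 + 1..0} = insert m {m + 1..0}" by auto
    thus ?thesis using False bb[of m] by (simp add: s_def flip: mult.assoc)
  qed
  have "s m * s (m - 1) = - b m" for m
    using rec[of m] s[of "m - 1"] by auto
  moreover have "s \<in> Omega" using s by (auto simp: Omega_def)
  ultimately show thesis using that by blast
qed

text \<open>
  Running the recurrence through one period of \<open>b\<close> multiplies \<open>s\<close> by a fixed sign, so \<open>s\<close>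
  itself repeats after at most two periods.
\<close>

lemma sign_recurrence_periodic:
  assumes s: "s \<in> Omega" and b: "\<And>m. s m * s (m - 1) = - b m" and p: "has_period b p"
  shows "has_period s (2 * p)"
proof -
  have s1: "s m = 1 \<or> s m = - 1" for m using s by (auto simp: Omega_def)
  have bp: "b (m + int p) = b m" for m using p by (simp add: has_period_def)
  define q where "q m = s (m + int p) * s m" for m
  \<comment> \<open>Moving \<open>m\<close> by one multiplies \<open>q\<close> by \<open>b\<^sub>m\<^sub>+\<^sub>p b\<^sub>m = b\<^sub>m\<^sup>2 = 1\<close>.\<close>
  have step: "q m = q (m - 1)" for m
    using b[of "m + int p"] b[of m] bp[of m] s1[of "m + int p"] s1[of m] s1[of "m - 1"]
      s1[of "m + int p - 1"]
    by (auto simp: q_def algebra_simps)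
  have "q m = q 0" for m
  proof (induction m rule: int_induct[where k = 0])
    case (step1 i) thus ?case using step[of "i + 1"] by simp
  next
    case (step2 i) thus ?case using step[of i] by simp
  qed simp
  hence q: "q (m + int p) = q m" for m by metis
  have "s (m + int p + int p) = s m" for m
    using q[of m] s1[of "m + int p + int p"] s1[of "m + int p"] s1[of m] by (auto simp: q_def)
  thus ?thesis using p by (simp add: has_period_def algebra_simps)
qed

lemma has_period_sign_pairs:
  assumes "has_period s p"
  shows "has_period (sign_pairs s) (2 * p)"
proof -
  have "(n + int (2 * p)) div 2 = n div 2 + int p" for n by simp
  moreover have "even (n + int (2 * p)) = even n" for n by simp
  ultimately show ?thesis
    using assms unfolding has_period_def sign_pairs_def by (auto simp only: mult_pos_pos)
qed

lemma pi_infinity_square_root: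
  assumes "z\<^sup>2 \<in> pi_infinity"
  shows "z \<in> pi_infinity"
proof -
  obtain b p where b: "b \<in> Omega" "has_period b p" "z\<^sup>2 \<in> Spec (hop b)"
    using assms by (auto simp: pi_infinity_iff)
  obtain s where s: "s \<in> Omega" "\<And>m. s m * s (m - 1) = - b m"
    using sign_recurrence_solvable[OF b(1)] by blast
  have Om: "sign_pairs s \<in> Omega"
  proof -
    have "s m = 1 \<or> s m = - 1" for m using s(1) by (auto simp: Omega_def)
    hence "sign_pairs s n = 1 \<or> sign_pairs s n = - 1" for n
      by (metis minus_minus sign_pairs_def)
    thus ?thesis by (simp add: Omega_def)
  qed
  have "has_period (sign_pairs s) (2 * (2 * p))"
    by (intro has_period_sign_pairs sign_recurrence_periodic[OF s b(2)])
  moreover have "z \<in> Spec (hop (sign_pairs s))"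
    by (rule Spec_hop_square_root[OF Om s(2) b(3)])
  ultimately show ?thesis using Om by (auto simp: pi_infinity_iff)
qed

lemma pi_infinity_root:
  "z ^ (2 ^ n) \<in> pi_infinity \<Longrightarrow> z \<in> pi_infinity"
proof (induction n arbitrary: z)
  case (Suc n)
  have "(z\<^sup>2) ^ (2 ^ n) \<in> pi_infinity" using Suc.prems by (simp add: power_mult)
  thus ?case by (rule pi_infinity_square_root[OF Suc.IH])
qed simp

section \<open>Constant sequences\<close>

lemma ell2_norm_finite_support:
  assumes "finite I" "\<And>n. n \<notin> I \<Longrightarrow> f n = 0"
  shows "f \<in> ell2" "ell2_norm f = sqrt (\<Sum>n\<in>I. (cmod (f n))\<^sup>2)"
proof -
  have "((\<lambda>n. (cmod (f n))\<^sup>2) has_sum (\<Sum>n\<in>I. (cmod (f n))\<^sup>2)) UNIV"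
    by (rule has_sum_finite_neutralI) (use assms in auto)
  thus "f \<in> ell2" "ell2_norm f = sqrt (\<Sum>n\<in>I. (cmod (f n))\<^sup>2)"
    by (auto simp: ell2_def ell2_norm_def infsumI summable_on_def)
qed

text \<open>
  The plane wave \<open>n \<mapsto> u\<^sup>n\<close> is a bounded formal eigenfunction. Cut off to a window of length \<open>N\<close>
  its norm grows like \<open>\<surd>N\<close>, while the defect sits at the two ends of the window and stays bounded,
  which no bounded inverse allows.
\<close>

lemma plane_wave_in_Spec:
  assumes u: "cmod u = 1" and \<epsilon>: "cmod \<epsilon> = 1"
  shows "\<epsilon> / u + u \<in> Spec (hop (\<lambda>_. \<epsilon>))"
proof (rule ccontr)
  define A where "A = (\<lambda>f n. hop (\<lambda>_. \<epsilon>) f n - (\<epsilon> / u + u) * f n)"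
  assume "\<epsilon> / u + u \<notin> Spec (hop (\<lambda>_. \<epsilon>))"
  then obtain B K where B: "\<And>f. f \<in> ell2 \<Longrightarrow> B (A f) = f"
    and K: "\<And>f. f \<in> ell2 \<Longrightarrow> ell2_norm (B f) \<le> K * ell2_norm f"
    unfolding Spec_iff_not_invertible ell2_invertible_def A_def bounded_op_def not_not by blast
  \<comment> \<open>The defect below lives on at most 4 sites and has modulus at most 2 there, so its norm
      is at most 4; the truncated wave has norm \<open>\<surd>N\<close>.\<close>
  obtain N :: nat where N: "(\<bar>K\<bar> * 4)\<^sup>2 < real N"
    using reals_Archimedean2 by blast
  have u0: "u \<noteq> 0" using u by auto
  define w :: "int \<Rightarrow> complex" where "w n = of_bool (n \<in> {0..<int N})" for n
  define f where "f = (\<lambda>n. w n * u powi n)"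
  have "f \<in> ell2" and "ell2_norm f = sqrt (\<Sum>n\<in>{0..<int N}. (cmod (f n))\<^sup>2)"
    using ell2_norm_finite_support[of "{0..<int N}" f] by (simp_all add: f_def w_def)
  moreover have "(\<Sum>n\<in>{0..<int N}. (cmod (f n))\<^sup>2) = (\<Sum>n\<in>{0..<int N}. 1)"
    by (rule sum.cong) (auto simp: f_def w_def norm_mult norm_power_int u)
  ultimately have f: "f \<in> ell2" "ell2_norm f = sqrt N" by auto

  have Af_eq: "A f n = \<epsilon> * u powi (n - 1) * (w (n - 1) - w n)
      + u powi (n + 1) * (w (n + 1) - w n)" for n
    using u0 by (simp add: A_def hop_def f_def power_int_diff power_int_add field_simps)
  define I where "I = {- 1, 0, int N - 1, int N}"
  have "A f n = 0" if "n \<notin> I" for n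
  proof -
    have "w (n - 1) = w n" "w (n + 1) = w n"
      using that by (auto simp: w_def I_def)
    thus ?thesis by (simp add: Af_eq)
  qed
  hence Af: "A f \<in> ell2" "ell2_norm (A f) = sqrt (\<Sum>n\<in>I. (cmod (A f n))\<^sup>2)"
    using ell2_norm_finite_support[of I "A f"] by (auto simp: I_def)
  have "(cmod (A f n))\<^sup>2 \<le> 4" for n
  proof -
    have "cmod (w m - w n) \<le> 1" for m by (simp add: w_def)
    hence "cmod (A f n) \<le> 1 + 1"
      unfolding Af_eq by (intro norm_triangle_mono) (simp_all add: norm_mult norm_power_int u \<epsilon>)
    hence "(cmod (A f n))\<^sup>2 \<le> 2\<^sup>2" by (intro power_mono) auto
    thus ?thesis by simp
  qed
  hence "(\<Sum>n\<in>I. (cmod (A f n))\<^sup>2) \<le> of_nat (card I) * 4"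
    by (intro sum_bounded_above)
  also have "card I \<le> 4" by (simp add: I_def card_insert_if)
  finally have "ell2_norm (A f) \<le> sqrt (4\<^sup>2)"
    unfolding Af by (intro real_sqrt_le_mono) auto
  hence "\<bar>K\<bar> * ell2_norm (A f) \<le> \<bar>K\<bar> * 4"
    by (intro mult_left_mono) auto
  moreover have "K * ell2_norm (A f) \<le> \<bar>K\<bar> * ell2_norm (A f)"
    by (intro mult_right_mono ell2_norm_nonneg) simp
  moreover have "sqrt N \<le> K * ell2_norm (A f)"
    using K[OF Af(1)] B[OF f(1)] f(2) by simp
  ultimately have "sqrt N \<le> \<bar>K\<bar> * 4" by linarith
  hence "real N \<le> (\<bar>K\<bar> * 4)\<^sup>2" by (rule sqrt_le_D)
  thus False using N by simp
qed

lemma coordinate_axes_subset_pi_infinity: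
  assumes "- 2 \<le> x" "x \<le> 2"
  shows "complex_of_real x \<in> pi_infinity" "\<i> * complex_of_real x \<in> pi_infinity"
proof -
  have const: "\<epsilon> / u + u \<in> pi_infinity" if "\<epsilon> \<in> {1, - 1}" "cmod u = 1" for \<epsilon> u
    unfolding pi_infinity_iff using that
    by (intro bexI[of _ "\<lambda>_. \<epsilon>"] exI[of _ 1] conjI plane_wave_in_Spec)
      (auto simp: has_period_def Omega_def)
  have inv: "1 / cis a = cis (- a)" for a
    by (metis cis_inverse inverse_eq_divide)
  have "1 / cis (arccos (x / 2)) + cis (arccos (x / 2)) = complex_of_real x"
    unfolding inv using assms by (simp add: complex_eq_iff)
  thus "complex_of_real x \<in> pi_infinity"
    using const[of 1 "cis (arccos (x / 2))"] by simp
  have "- 1 / cis (arcsin (x / 2)) + cis (arcsin (x / 2)) = \<i> * complex_of_real x"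
    unfolding minus_divide_left[symmetric] inv using assms by (simp add: complex_eq_iff)
  thus "\<i> * complex_of_real x \<in> pi_infinity"
    using const[of "- 1" "cis (arcsin (x / 2))"] by simp
qed

section \<open>Rays and density\<close>

text \<open>
  Raising to the power \<open>2\<^sup>n\<close> multiplies the angle \<open>\<pi> r / 2\<^sup>n\<^sup>+\<^sup>1\<close> to \<open>r\<close> right angles and the
  length \<open>2\<^bsup>1/2^n\<^esup>\<close> to 2, so the whole ray lands in the cross formed by the spectra of the two
  constant sequences.
\<close>

lemma cis_in_pi_infinity:
  assumes "0 \<le> t" "t \<le> 2 powr (1 / 2 ^ n)"
  shows "cis (pi * real r / 2 ^ (n + 1)) * complex_of_real t \<in> pi_infinity"
proof (rule pi_infinity_root[of _ n])
  define x where "x = t ^ (2 ^ n)"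
  have "x \<le> (2 powr (1 / 2 ^ n)) ^ (2 ^ n)"
    unfolding x_def by (rule power_mono) (use assms in auto)
  also have "\<dots> = 2" by (simp add: powr_powr flip: powr_realpow)
  finally have x: "0 \<le> x" "x \<le> 2" using assms by (auto simp: x_def)
  have "cis (pi * real r / 2 ^ (n + 1)) ^ (2 ^ n) = cis (real r * (pi / 2))"
  proof -
    have "real (2 ^ n) * (pi * real r / 2 ^ (n + 1)) = real r * (pi / 2)" by simp
    thus ?thesis unfolding Complex.DeMoivre by (simp only:)
  qed
  also have "\<dots> = \<i> ^ r" unfolding Complex.DeMoivre[symmetric] by simp
  finally have eq: "(cis (pi * real r / 2 ^ (n + 1)) * complex_of_real t) ^ (2 ^ n)
      = \<i> ^ r * complex_of_real x"
    by (simp add: power_mult_distrib x_def)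
  have ax: "complex_of_real x \<in> pi_infinity" "- complex_of_real x \<in> pi_infinity"
    "\<i> * complex_of_real x \<in> pi_infinity" "- (\<i> * complex_of_real x) \<in> pi_infinity"
    using coordinate_axes_subset_pi_infinity[of x] coordinate_axes_subset_pi_infinity[of "- x"] x
    by auto
  have pow: "\<i> ^ r \<in> {1, - 1, \<i>, - \<i>}"
    by (induction r) auto
  show "(cis (pi * real r / 2 ^ (n + 1)) * complex_of_real t) ^ (2 ^ n) \<in> pi_infinity"
    unfolding eq using pow ax by auto
qed

lemma dist_cis_le: "cmod (cis a - cis b) \<le> \<bar>a - b\<bar>"
proof -
  have "cis a - cis b = cis b * (cis (a - b) - 1)"
    by (simp add: right_diff_distrib cis_mult)
  hence "cmod (cis a - cis b) = 2 * \<bar>sin ((a - b) / 2)\<bar>"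
    using dist_exp_i_1[of "a - b"] by (simp add: norm_mult cis_conv_exp)
  also have "\<dots> \<le> \<bar>a - b\<bar>"
    using abs_sin_x_le_abs_x[of "(a - b) / 2"] by simp
  finally show ?thesis .
qed

lemma unit_disc_subset_closure: "cball 0 1 \<subseteq> closure (pi_infinity \<inter> {z. cmod z \<le> 1})"
proof
  fix w :: complex assume "w \<in> cball 0 1"
  hence w: "cmod w \<le> 1" by simp
  define \<theta> where "\<theta> = Arg2pi w"
  have \<theta>: "0 \<le> \<theta>" and w_eq: "w = cis \<theta> * complex_of_real (cmod w)"
    using Arg2pi[of w] by (simp_all add: \<theta>_def cis_conv_exp is_Arg_def mult.commute)
  show "w \<in> closure (pi_infinity \<inter> {z. cmod z \<le> 1})"
    unfolding closure_approachable
  proof (intro allI impI)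
    fix e :: real assume e: "e > 0"
    obtain n :: nat where n: "(1 / 2) ^ n < e / pi"
      using real_arch_pow_inv[of "e / pi" "1 / 2"] e by auto
    \<comment> \<open>Rotating \<open>w\<close> to the nearest lower direction of level \<open>n\<close> keeps its modulus, which is
        below the length of every ray.\<close>
    define r where "r = nat \<lfloor>\<theta> * 2 ^ (n + 1) / pi\<rfloor>"
    define a where "a = pi * real r / 2 ^ (n + 1)"
    have "real r = \<lfloor>\<theta> * 2 ^ (n + 1) / pi\<rfloor>" using \<theta> by (simp add: r_def)
    hence "\<bar>real r - \<theta> * 2 ^ (n + 1) / pi\<bar> \<le> 1" by linarith
    hence "\<bar>real r - \<theta> * 2 ^ (n + 1) / pi\<bar> * (pi / 2 ^ (n + 1)) \<le> 1 * (pi / 2 ^ (n + 1))"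
      by (rule mult_right_mono) simp
    also have "\<bar>real r - \<theta> * 2 ^ (n + 1) / pi\<bar> * (pi / 2 ^ (n + 1))
        = \<bar>(real r - \<theta> * 2 ^ (n + 1) / pi) * (pi / 2 ^ (n + 1))\<bar>"
      by (simp add: abs_mult)
    also have "(real r - \<theta> * 2 ^ (n + 1) / pi) * (pi / 2 ^ (n + 1)) = a - \<theta>"
      by (simp add: a_def field_simps)
    finally have a: "\<bar>a - \<theta>\<bar> \<le> pi / 2 ^ (n + 1)" by simp
    define v where "v = cis a * complex_of_real (cmod w)"
    have "v - w = (cis a - cis \<theta>) * complex_of_real (cmod w)"
      by (subst w_eq) (simp add: v_def algebra_simps)
    hence "dist v w = cmod (cis a - cis \<theta>) * cmod w"
      by (simp add: dist_norm norm_mult)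
    also have "\<dots> \<le> cmod (cis a - cis \<theta>)" using w by (simp add: mult_left_le)
    also have "\<dots> \<le> pi / 2 ^ (n + 1)" using dist_cis_le a by (rule order_trans)
    also have "\<dots> \<le> pi * (1 / 2) ^ n" by (simp add: field_simps)
    also have "\<dots> < e" using n by (simp add: field_simps)
    finally have "dist v w < e" .
    moreover have "v \<in> pi_infinity"
      unfolding v_def a_def
    proof (rule cis_in_pi_infinity)
      have "cmod w \<le> 2 powr 0" using w by simp
      also have "\<dots> \<le> 2 powr (1 / 2 ^ n)" by (rule powr_mono) auto
      finally show "cmod w \<le> 2 powr (1 / 2 ^ n)" .
    qed simp
    moreover have "cmod v \<le> 1" using w by (simp add: v_def norm_mult)
    ultimately show "\<exists>y\<in>pi_infinity \<inter> {z. cmod z \<le> 1}. dist y w < e" by blast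
  qed
qed

theorem theorem15:
  shows "(\<Union>n::nat. \<Union>r\<in>{0..2 ^ (n + 2)::nat}.
            scale_interval (exp (of_real pi * \<i> * of_nat r / 2 ^ (n + 1)))
              {0..2 powr (1 / 2 ^ n)}) \<subseteq> pi_infinity
    \<and> cball 0 1 \<subseteq> closure (pi_infinity \<inter> {z. cmod z \<le> 1})"
proof
  have "exp (of_real pi * \<i> * of_nat r / 2 ^ (n + 1)) = cis (pi * real r / 2 ^ (n + 1))" for n r
    by (simp add: cis_conv_exp mult_ac)
  thus "(\<Union>n::nat. \<Union>r\<in>{0..2 ^ (n + 2)::nat}.
            scale_interval (exp (of_real pi * \<i> * of_nat r / 2 ^ (n + 1)))
              {0..2 powr (1 / 2 ^ n)}) \<subseteq> pi_infinity"
    using cis_in_pi_infinity by (auto simp: scale_interval_def simp del: power_Suc)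
qed (rule unit_disc_subset_closure)

end
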